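(* Let $n\ge 12$. (i) For the complement of the path $P_n$ on $n$ vertices, $\gamma_{MR}(\overline{P_n})=-1$. (ii) For the complement of the cycle $C_n$ on $n$ vertices, $\gamma_{MR}(\overline{C_n})=-1$.
   Context: All graphs are finite and simple. For a vertex $v$ of $G=(V,E)$, $N[v]=\{v\}\cup\{u: uv\in E\}$ is the closed neighborhood, and for $f:V\to\mathbb{R}$ and $S\subseteq V$, $f(S)=\sum_{x\in S}f(x)$. A majority Roman dominating function (MRDF) on $G$ is a function $f:V\to\{-1,1,2\}$ such that (i) $f(N[v])\ge 1$ for at least half of the vertices $v\in V$, and (ii) every vertex $u$ with $f(u)=-1$ is adjacent to at least one vertex $w$ with $f(w)=2$. The weight of $f$ is $f(V)$, and the majority Roman domination number $\gamma_{MR}(G)$ is the minimum weight of an MRDF on $G$. $\overline{G}$ denotes the complement of $G$. *)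

theory Defs
  imports "Graph_Theory.Pair_Digraph"
begin

text \<open>
  A finite simple graph is a \<^locale>\<open>pair_graph\<close>: a finite vertex set with a symmetric
  irreflexive set of arcs, so that an edge \<open>uv\<close> is the pair of arcs \<open>(u, v)\<close> and \<open>(v, u)\<close>.
\<close>

section \<open>Complements, paths and cycles\<close>

definition complement :: "'a pair_pre_digraph \<Rightarrow> 'a pair_pre_digraph" where
  "complement G = \<lparr> pverts = pverts G,
     parcs = {(u, v). u \<in> pverts G \<and> v \<in> pverts G \<and> u \<noteq> v \<and> (u, v) \<notin> parcs G} \<rparr>"

definition path_graph :: "nat \<Rightarrow> nat pair_pre_digraph" where
  "path_graph n = \<lparr> pverts = {0..<n},
     parcs = {(i, j). i < n \<and> j < n \<and> (j = Suc i \<or> i = Suc j)} \<rparr>"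

text \<open>This is a cycle only for \<open>n \<ge> 3\<close>; for \<open>n = 1\<close> it has a loop.\<close>

definition cycle_graph :: "nat \<Rightarrow> nat pair_pre_digraph" where
  "cycle_graph n = \<lparr> pverts = {0..<n},
     parcs = {(i, j). i < n \<and> j < n \<and> (j = Suc i mod n \<or> i = Suc j mod n)} \<rparr>"

lemma pair_graph_complement:
  assumes "pair_graph G"
  shows "pair_graph (complement G)"
proof -
  interpret pair_graph G by fact
  have "parcs (complement G) \<subseteq> pverts G \<times> pverts G"
    by (auto simp: complement_def)
  then have "finite (parcs (complement G))"
    using pair_finite_verts finite_subset by blast
  moreover have "sym (parcs G)"
    using pair_sym_arcs by (simp add: symmetric_def)
  ultimately show ?thesis
    using pair_finite_verts
    by unfold_locales (auto simp: complement_def symmetric_def sym_def)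
qed

lemma pair_graph_path_graph: "pair_graph (path_graph n)"
proof -
  have "parcs (path_graph n) \<subseteq> {0..<n} \<times> {0..<n}"
    by (auto simp: path_graph_def)
  then have "finite (parcs (path_graph n))"
    using finite_subset by blast
  then show ?thesis
    by unfold_locales (auto simp: path_graph_def symmetric_def sym_def)
qed

lemma pair_graph_cycle_graph:
  assumes "n \<ge> 3"
  shows "pair_graph (cycle_graph n)"
proof -
  have "parcs (cycle_graph n) \<subseteq> {0..<n} \<times> {0..<n}"
    by (auto simp: cycle_graph_def)
  then have "finite (parcs (cycle_graph n))"
    using finite_subset by blast
  moreover have "i \<noteq> Suc i mod n" "Suc i mod n \<noteq> i" if "i < n" for i
    using that assms by (cases "Suc i = n"; simp)+
  ultimately show ?thesis
    by unfold_locales (auto simp: cycle_graph_def symmetric_def sym_def)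
qed


section \<open>Majority Roman domination\<close>

definition closed_nbhd :: "'a pair_pre_digraph \<Rightarrow> 'a \<Rightarrow> 'a set" where
  "closed_nbhd G v = {v} \<union> {u. (u, v) \<in> parcs G}"

text \<open>
  Functions on the vertex set are total functions of which only the values on
  \<^term>\<open>pverts G\<close> matter.
\<close>

definition MRDF :: "'a pair_pre_digraph \<Rightarrow> ('a \<Rightarrow> int) \<Rightarrow> bool" where
  "MRDF G f \<longleftrightarrow>
     (\<forall>v \<in> pverts G. f v \<in> {-1, 1, 2}) \<and>
     real (card {v \<in> pverts G. sum f (closed_nbhd G v) \<ge> 1}) \<ge> real (card (pverts G)) / 2 \<and>
     (\<forall>u \<in> pverts G. f u = -1 \<longrightarrow> (\<exists>w \<in> pverts G. (u, w) \<in> parcs G \<and> f w = 2))"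

definition gamma_MR :: "'a pair_pre_digraph \<Rightarrow> int" where
  "gamma_MR G = Min {sum f (pverts G) | f. MRDF G f}"

text \<open>The minimum ranges over a finite nonempty set, so it is always attained.\<close>

lemma finite_MRDF_weights:
  assumes "pair_graph G"
  shows "finite {sum f (pverts G) | f. MRDF G f}"
proof -
  interpret pair_graph G by fact
  let ?n = "int (card (pverts G))"
  have "- ?n \<le> sum f (pverts G) \<and> sum f (pverts G) \<le> 2 * ?n" if "MRDF G f" for f
  proof -
    have "-1 \<le> f v \<and> f v \<le> 2" if "v \<in> pverts G" for v
      using \<open>MRDF G f\<close> that by (fastforce simp: MRDF_def)
    then show ?thesis
      using sum_bounded_below[of "pverts G" "-1" f] sum_bounded_above[of "pverts G" f 2]
      by (simp add: mult.commute)
  qed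
  then have "{sum f (pverts G) | f. MRDF G f} \<subseteq> {- ?n..2 * ?n}"
    by auto
  then show ?thesis
    using finite_subset by blast
qed

lemma MRDF_const_1:
  assumes "pair_graph G"
  shows "MRDF G (\<lambda>_. 1)"
proof -
  interpret pair_graph G by fact
  have "card (closed_nbhd G v) \<ge> 1" if "v \<in> pverts G" for v
  proof -
    have "closed_nbhd G v \<subseteq> pverts G"
      using that by (auto simp: closed_nbhd_def dest: in_arcsD1)
    then have "finite (closed_nbhd G v)"
      using pair_finite_verts finite_subset by blast
    then show ?thesis
      by (simp add: Suc_le_eq card_gt_0_iff) (auto simp: closed_nbhd_def)
  qed
  then have "{v \<in> pverts G. sum (\<lambda>_. 1::int) (closed_nbhd G v) \<ge> 1} = pverts G"
    by fastforce
  then show ?thesis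
    by (simp add: MRDF_def)
qed

lemma gamma_MR_attained:
  assumes "pair_graph G"
  shows "\<exists>f. MRDF G f \<and> sum f (pverts G) = gamma_MR G"
proof -
  have "{sum f (pverts G) | f. MRDF G f} \<noteq> {}"
    using MRDF_const_1[OF assms] by auto
  from Min_in[OF finite_MRDF_weights[OF assms] this] show ?thesis
    by (auto simp: gamma_MR_def)
qed

lemma gamma_MR_le:
  assumes "pair_graph G" "MRDF G f"
  shows "gamma_MR G \<le> sum f (pverts G)"
  unfolding gamma_MR_def
  using assms by (intro Min_le finite_MRDF_weights) auto

end

theory Submission
  imports Defs
begin

text \<open>
  If \<open>u\<close> has at most two neighbours in \<open>G\<close>, then its closed neighbourhood in the complement of
  \<open>G\<close> omits at most two vertices, so its sum exceeds the weight by at most \<open>2\<close>.  Hence a weight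
  below \<open>-1\<close> leaves no vertex with closed neighbourhood sum at least \<open>1\<close>.

  Conversely, assign \<open>-1\<close> to all even vertices of the path or cycle and to the vertices \<open>1\<close> and
  \<open>3\<close>, and \<open>2\<close> to the vertices \<open>5\<close>, \<open>7\<close>, \<open>9\<close> (and \<open>11\<close> if \<open>n\<close> is odd), and \<open>1\<close> to the
  remaining ones.  The weight is \<open>-1\<close>, and all odd inner vertices as well as the vertex \<open>2\<close> have
  two neighbours of value \<open>-1\<close>, which are missing from the neighbourhood in the complement.
\<close>

lemma closed_nbhd_complement:
  assumes "pair_graph G" "v \<in> pverts G"
  shows "closed_nbhd (complement G) v = pverts G - {u. (u, v) \<in> parcs G}"
proof -
  interpret pair_graph G by fact
  have "(v, v) \<notin> parcs G"
    using pair_no_loops by fastforce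
  then show ?thesis
    using assms(2) by (auto simp: closed_nbhd_def complement_def)
qed

lemma sum_closed_nbhd_complement:
  fixes f :: "'a \<Rightarrow> int"
  assumes "pair_graph G" "v \<in> pverts G"
  shows "sum f (closed_nbhd (complement G) v) = sum f (pverts G) - sum f {u. (u, v) \<in> parcs G}"
proof -
  interpret pair_graph G by fact
  have "{u. (u, v) \<in> parcs G} \<subseteq> pverts G"
    by (auto dest: in_arcsD1)
  then show ?thesis
    using assms by (simp add: closed_nbhd_complement sum_diff)
qed

lemma gamma_MR_complement_ge:
  assumes "pair_graph G" "pverts G \<noteq> {}"
    and deg: "\<And>v. v \<in> pverts G \<Longrightarrow> card {u. (u, v) \<in> parcs G} \<le> 2"
  shows "gamma_MR (complement G) \<ge> -1"
proof -
  interpret pair_graph G by fact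
  have V: "pverts (complement G) = pverts G"
    by (simp add: complement_def)
  obtain f where f: "MRDF (complement G) f"
      and w: "sum f (pverts G) = gamma_MR (complement G)"
    using gamma_MR_attained[OF pair_graph_complement[OF assms(1)]] V by auto
  have "card (pverts G) > 0"
    using assms(2) by (simp add: card_gt_0_iff)
  \<comment> \<open>Half of a nonempty vertex set is a positive amount, so the majority condition
    yields at least one vertex to work with.\<close>
  then have "card {v \<in> pverts G. sum f (closed_nbhd (complement G) v) \<ge> 1} \<noteq> 0"
    using f V by (auto simp: MRDF_def simp del: card_eq_0_iff card_0_eq)
  then obtain v where v: "v \<in> pverts G" "sum f (closed_nbhd (complement G) v) \<ge> 1"
    by (metis (no_types, lifting) card.empty empty_Collect_eq)
  let ?N = "{u. (u, v) \<in> parcs G}"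
  have "f u \<ge> -1" if "u \<in> ?N" for u
  proof -
    have "u \<in> pverts G"
      using that by (auto dest: in_arcsD1)
    then show ?thesis
      using f V by (fastforce simp: MRDF_def)
  qed
  then have "sum f ?N \<ge> of_nat (card ?N) * (-1)"
    by (rule sum_bounded_below)
  then have "sum f ?N \<ge> -2"
    using deg[OF v(1)] by linarith
  then show ?thesis
    using v(2) w sum_closed_nbhd_complement[OF assms(1) v(1), of f] by linarith
qed

definition witness :: "bool \<Rightarrow> nat \<Rightarrow> int" where
  "witness b i =
     (if even i \<or> i \<in> {1, 3} then -1
      else if i \<in> {5, 7, 9} \<or> b \<and> i = 11 then 2 else 1)"

text \<open>From vertex 12 on the values alternate between -1 and 1, so only the parity of
  \<open>k\<close> matters. For odd \<open>k\<close> the last -1 is unpaired; the flag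
  \<open>b\<close>, instantiated with \<open>odd n\<close>, makes up for it by raising the value at
  11 from 1 to 2.\<close>

lemma sum_witness:
  "sum (witness b) {0..<12 + k} = (if even k then -1 else -2) + (if b then 1 else 0)"
proof (induction k)
  case 0
  have "{0..<12} = {0, 1, 2, 3, 4, 5, 6, 7, 8, 9, 10, 11 :: nat}"
    by (simp add: atLeast0LessThan lessThan_nat_numeral lessThan_Suc numeral_eq_Suc insert_commute)
  then show ?case
    by (simp add: witness_def)
next
  case (Suc k)
  have "witness b (12 + k) = (if even k then -1 else 1)"
    by (auto simp: witness_def)
  with Suc show ?case
    by (simp only: add_Suc_right sum.atLeast0_lessThan_Suc) simp
qed

lemma gamma_MR_complement_le:
  assumes "pair_graph G" "pverts G = {0..<n}" "n \<ge> 12"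
    and nbrs: "\<And>v. 0 < v \<Longrightarrow> Suc v < n \<Longrightarrow> {u. (u, v) \<in> parcs G} = {v - 1, Suc v}"
  shows "gamma_MR (complement G) \<le> -1"
proof -
  define f where "f = witness (odd n)"
  have V: "pverts (complement G) = {0..<n}"
    using assms(2) by (simp add: complement_def)
  obtain k where k: "n = 12 + k"
    using assms(3) le_Suc_ex by blast
  have weight: "sum f {0..<n} = -1"
    unfolding f_def using sum_witness[of "odd n" k] by (auto simp: k)
  have good: "sum f (closed_nbhd (complement G) v) \<ge> 1"
    if "0 < v" "Suc v < n" "f (v - 1) = -1" "f (Suc v) = -1" for v
    using that sum_closed_nbhd_complement[OF assms(1), of v f] weight
    by (simp add: assms(2) nbrs)
  let ?good = "{v \<in> {0..<n}. sum f (closed_nbhd (complement G) v) \<ge> 1}"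
  \<comment> \<open>The bound on \<open>k\<close> says that \<open>2 * k + 2 < n\<close>, so these
    are the odd inner vertices. They fall short of half of all vertices by 1 if \<open>n\<close> is
    even and by 1/2 if \<open>n\<close> is odd. Vertex 2 closes the gap, which is why 1 and 3 carry
    the value -1.\<close>
  let ?odds = "(\<lambda>k. 2 * k + 1) ` {..<(n - 1) div 2}"
  have "insert 2 ?odds \<subseteq> ?good"
  proof -
    have "2 \<in> ?good"
      using good[of 2] assms(3) by (simp add: f_def witness_def)
    moreover have "2 * k + 1 \<in> ?good" if "k < (n - 1) div 2" for k
      using good[of "2 * k + 1"] that by (simp add: f_def witness_def)
    ultimately show ?thesis
      by auto
  qed
  moreover have "card (insert 2 ?odds) = (n - 1) div 2 + 1"
  proof -
    have "2 \<notin> ?odds"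
      by (auto; presburger)
    moreover have "card ?odds = (n - 1) div 2"
      by (subst card_image) (auto simp: inj_on_def)
    ultimately show ?thesis
      by simp
  qed
  ultimately have "(n - 1) div 2 + 1 \<le> card ?good"
    using card_mono[of ?good "insert 2 ?odds"] by simp
  then have half: "real (card ?good) \<ge> real n / 2"
    by linarith
  have guarded: "\<exists>w \<in> {0..<n}. (u, w) \<in> parcs (complement G) \<and> f w = 2"
    if "u < n" "f u = -1" for u
  proof -
    \<comment> \<open>A vertex of value 2 that is not next to \<open>u\<close> in \<open>G\<close>:
      the neighbours of 9 are 8 and 10, those of 5 are 4 and 6. Both 5 and 9 are inner vertices
      since \<open>n \<ge> 12\<close>.\<close>
    define w :: nat where "w = (if u \<le> 6 then 9 else 5)"
    have w: "0 < w" "Suc w < n" "f w = 2"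
      using assms(3) by (auto simp: w_def f_def witness_def)
    have "u \<noteq> w - 1" "u \<noteq> Suc w"
      by (auto simp: w_def)
    then have "(u, w) \<notin> parcs G"
      using nbrs[OF w(1,2)] by blast
    moreover have "u \<noteq> w"
      using that w by auto
    ultimately show ?thesis
      using that w assms(2) by (intro bexI[of _ w]) (auto simp: complement_def)
  qed
  have "MRDF (complement G) f"
    unfolding MRDF_def V using half guarded
    by (auto simp: f_def witness_def)
  from gamma_MR_le[OF pair_graph_complement[OF assms(1)] this] show ?thesis
    using weight V by simp
qed

text \<open>Treats path and cycle together: they differ only at 0 and \<open>n - 1\<close>, where
  inclusions suffice to bound the degree by 2.\<close>

lemma gamma_MR_complement_eq:
  assumes "pair_graph G" "pverts G = {0..<n}" "n \<ge> 12"
    and "\<And>v. 0 < v \<Longrightarrow> Suc v < n \<Longrightarrow> {u. (u, v) \<in> parcs G} = {v - 1, Suc v}"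
    and ends: "{u. (u, 0) \<in> parcs G} \<subseteq> {1, n - 1}" "{u. (u, n - 1) \<in> parcs G} \<subseteq> {0, n - 2}"
  shows "gamma_MR (complement G) = -1"
proof (rule antisym)
  show "gamma_MR (complement G) \<ge> -1"
  proof (rule gamma_MR_complement_ge[OF assms(1)])
    fix v assume "v \<in> pverts G"
    then consider "v = 0" | "0 < v" "Suc v < n" | "v = n - 1"
      using assms(2) by fastforce
    then have "\<exists>a b. {u. (u, v) \<in> parcs G} \<subseteq> {a, b}"
      using assms(4) ends by cases blast+
    then obtain a b where ab: "{u. (u, v) \<in> parcs G} \<subseteq> {a, b}"
      by blast
    have "card {u. (u, v) \<in> parcs G} \<le> card {a, b}"
      by (intro card_mono ab) simp
    also have "\<dots> \<le> 2"
      by (simp add: card_insert_if)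
    finally show "card {u. (u, v) \<in> parcs G} \<le> 2" .
  qed (use assms in auto)
qed (rule gamma_MR_complement_le[OF assms(1-4)])

lemma Suc_mod_if: "i < n \<Longrightarrow> Suc i mod n = (if Suc i = n then 0 else Suc i)"
  by auto

theorem proposition8:
  fixes n :: nat
  assumes "n \<ge> 12"
  shows "gamma_MR (complement (path_graph n)) = -1 \<and>
         gamma_MR (complement (cycle_graph n)) = -1"
proof
  show "gamma_MR (complement (path_graph n)) = -1"
    by (rule gamma_MR_complement_eq[OF pair_graph_path_graph _ assms])
      (use assms in \<open>auto simp: path_graph_def\<close>)
  have "pair_graph (cycle_graph n)"
    using assms by (intro pair_graph_cycle_graph) simp
  then show "gamma_MR (complement (cycle_graph n)) = -1"
    by (rule gamma_MR_complement_eq[OF _ _ assms])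
      (use assms in \<open>auto simp: cycle_graph_def Suc_mod_if split: if_splits dest: dvd_imp_le\<close>)
qed

end
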